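(* Let $q$ be a prime power. For every integer $N$ with $q^2+1\le N\le q^2+q$ there exists a maximal partial spread of $H(3,q^2)$ of size $N$.
   Context: $H(3,q^2)$ is the hermitian polar space of $\mathrm{PG}(3,q^2)$: the subspaces totally isotropic with respect to a non-degenerate hermitian form on $\mathbb{F}_{q^2}^4$; its maximal totally isotropic subspaces are lines. A partial spread of $H(3,q^2)$ is a set of pairwise disjoint totally isotropic lines; it is maximal if it is not strictly contained in a larger partial spread of $H(3,q^2)$. *)

theory Defs
  imports "HOL-Analysis.Analysis" "HOL-Number_Theory.Prime_Powers"
begin

text \<open>
  The field with \<open>q\<^sup>2\<close> elements is a type of classes \<open>field\<close> and \<open>finite\<close> with \<open>CARD('a) = q\<^sup>2\<close>.
  Subspaces of \<open>PG(3, q\<^sup>2)\<close> are represented by the corresponding linear subspaces of \<open>'a ^ 4\<close>,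
  so that projective lines are the linear subspaces of dimension 2.
\<close>

text \<open>
  The companion automorphism of a hermitian form is the involution \<open>c \<mapsto> c ^ q\<close> of the field with
  \<open>q\<^sup>2\<close> elements; semilinearity in the second argument follows from the conditions below.
\<close>

definition hermitian_form :: "nat \<Rightarrow> ('a::{field,finite} ^ 4 \<Rightarrow> 'a ^ 4 \<Rightarrow> 'a) \<Rightarrow> bool" where
  "hermitian_form q h \<longleftrightarrow>
     (\<forall>x y z. h (x + y) z = h x z + h y z) \<and>
     (\<forall>c x y. h (c *s x) y = c * h x y) \<and>
     (\<forall>x y. h y x = h x y ^ q)"

definition nondegenerate :: "('a::{field,finite} ^ 4 \<Rightarrow> 'a ^ 4 \<Rightarrow> 'a) \<Rightarrow> bool" where
  "nondegenerate h \<longleftrightarrow> (\<forall>x. (\<forall>y. h x y = 0) \<longrightarrow> x = 0)"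

definition totally_isotropic ::
    "('a::{field,finite} ^ 4 \<Rightarrow> 'a ^ 4 \<Rightarrow> 'a) \<Rightarrow> ('a ^ 4) set \<Rightarrow> bool" where
  "totally_isotropic h U \<longleftrightarrow> (\<forall>x\<in>U. \<forall>y\<in>U. h x y = 0)"

definition polar_space ::
    "('a::{field,finite} ^ 4 \<Rightarrow> 'a ^ 4 \<Rightarrow> 'a) \<Rightarrow> ('a ^ 4) set set" where
  "polar_space h = {U. vec.subspace U \<and> totally_isotropic h U}"

definition polar_lines ::
    "('a::{field,finite} ^ 4 \<Rightarrow> 'a ^ 4 \<Rightarrow> 'a) \<Rightarrow> ('a ^ 4) set set" where
  "polar_lines h = {U \<in> polar_space h. vec.dim U = 2}"

text \<open>
  Two lines are disjoint, i.e. have no projective point in common, iff the linear subspaces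
  meet only in the zero vector.
\<close>

definition partial_spread ::
    "('a::{field,finite} ^ 4 \<Rightarrow> 'a ^ 4 \<Rightarrow> 'a) \<Rightarrow> ('a ^ 4) set set \<Rightarrow> bool" where
  "partial_spread h S \<longleftrightarrow> S \<subseteq> polar_lines h \<and> pairwise (\<lambda>U W. U \<inter> W = {0}) S"

definition maximal_partial_spread ::
    "('a::{field,finite} ^ 4 \<Rightarrow> 'a ^ 4 \<Rightarrow> 'a) \<Rightarrow> ('a ^ 4) set set \<Rightarrow> bool" where
  "maximal_partial_spread h S \<longleftrightarrow>
     partial_spread h S \<and> \<not> (\<exists>T. partial_spread h T \<and> S \<subset> T)"

end

theory Submission
  imports Defs
begin

text \<open>
  Fix two disjoint lines \<open>l\<close> and \<open>m\<close>. The \<open>q\<^sup>2 + 1\<close> lines meeting both of them are pairwise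
  disjoint, since lines of a hermitian surface form no triangles. Given \<open>k < q\<close> of these
  transversals, replace each such \<open>L\<close> by a second line through the point \<open>L \<inter> l\<close> and a second line
  through \<open>L \<inter> m\<close>. The only possible intersections are between a new line at \<open>l\<close> and a new line at
  \<open>m\<close> coming from different transversals. A new line at \<open>m\<close> rules out at most one line through a
  given point of \<open>l\<close>, and there are \<open>q\<close> lines other than \<open>l\<close> through that point, so a greedy choice
  succeeds as long as \<open>k < q\<close>. The resulting partial spread has \<open>q\<^sup>2 + 1 + k\<close> lines. It is maximal:
  it covers \<open>l\<close> and \<open>m\<close>, and a line disjoint from both meets at least \<open>q > k\<close> transversals, because
  it is the graph of a map from \<open>l\<close> to \<open>m\<close> that induces a nondegenerate skew-hermitian form on \<open>l\<close>.
\<close>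

section \<open>Trace and norm over the subfield of order q\<close>

text \<open>Pigeonhole: at most \<open>m\<close> fibres of size at most \<open>n\<close> must add up
  to \<open>m * n\<close>, so no fibre can fall short. This turns the root bounds for the trace and
  norm polynomials into exact counts.\<close>

lemma card_fibre_eq_of_card_le:
  assumes "finite X" and "finite Y" and "f ` X \<subseteq> Y"
    and fibre: "\<And>y. y \<in> Y \<Longrightarrow> card {x \<in> X. f x = y} \<le> n"
    and "card Y \<le> m" and "card X = m * n" and "y \<in> Y"
  shows "card {x \<in> X. f x = y} = n"
proof (rule ccontr)
  assume "card {x \<in> X. f x = y} \<noteq> n"
  then have lt: "card {x \<in> X. f x = y} < n"
    using fibre[OF \<open>y \<in> Y\<close>] by simp
  have "X = (\<Union>y\<in>Y. {x \<in> X. f x = y})"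
    using assms(3) by blast
  then have "card X = (\<Sum>y\<in>Y. card {x \<in> X. f x = y})"
    using card_UN_disjoint[of Y "\<lambda>y. {x \<in> X. f x = y}"] assms(1,2) by force
  also have "\<dots> < (\<Sum>y\<in>Y. n)"
    by (rule sum_strict_mono_ex1) (use assms(2,7) fibre lt in auto)
  also have "\<dots> \<le> m * n"
    using assms(5) by simp
  finally show False
    using assms(6) by simp
qed

lemma card_roots_monic_le:
  fixes r :: "'a::field poly"
  assumes "degree r < n"
  shows "card {x. x ^ n + poly r x = 0} \<le> n"
proof -
  let ?p = "monom 1 n + r"
  have deg: "degree ?p = n"
    using assms by (simp add: degree_add_eq_left degree_monom_eq)
  with assms have "?p \<noteq> 0"
    by auto
  then have "card {x. poly ?p x = 0} \<le> n"
    using card_poly_roots_bound deg by metis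
  then show ?thesis
    by (simp add: poly_monom)
qed

locale quadratic_finite_field =
  fixes q :: nat and F :: "'a::{field,finite} itself"
  assumes q_primepow: "primepow q"
    and card_field: "CARD('a) = q\<^sup>2"
begin

lemma q_ge_2: "q \<ge> 2"
  using primepow_gt_Suc_0[OF q_primepow] by simp

lemma q_power_CHAR:
  obtains n where "q = CHAR('a) ^ n" and "prime CHAR('a)"
proof -
  have "CHAR('a) > 0"
    by (simp add: finite_imp_CHAR_pos)
  then have p: "prime CHAR('a)"
    by (rule prime_CHAR_semidom)
  obtain p n where pn: "prime p" "q = p ^ n"
    using q_primepow unfolding primepow_def by auto
  \<comment> \<open>Translation by 1 permutes the field, so comparing the two sums shows that the
    cardinality vanishes in the field. Hence the characteristic divides q^2.\<close>
  have "(\<Sum>x\<in>UNIV. x + 1 :: 'a) = \<Sum>UNIV"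
    by (rule sum.reindex_bij_witness[of _ "\<lambda>x. x - 1" "\<lambda>x. x + 1"]) auto
  then have "of_nat CARD('a) = (0 :: 'a)"
    by (simp add: sum.distrib)
  then have "CHAR('a) dvd (p ^ n)\<^sup>2"
    using of_nat_eq_0_iff_char_dvd card_field pn(2) by metis
  then have "CHAR('a) = p"
    using p pn(1) by (metis prime_dvd_power primes_dvd_imp_eq)
  then show thesis
    using that pn p by blast
qed

lemma conj_add: "(x + y :: 'a) ^ q = x ^ q + y ^ q"
  using q_power_CHAR freshmans_dream' by metis

lemma conj_zero [simp]: "(0 :: 'a) ^ q = 0"
  using q_ge_2 by simp

lemma conj_uminus: "(- x :: 'a) ^ q = - (x ^ q)"
  using conj_add[of x "- x"] by (simp add: eq_neg_iff_add_eq_0 add.commute)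

lemma conj_diff: "(x - y :: 'a) ^ q = x ^ q - y ^ q"
  using conj_add[of x "- y"] by (simp add: conj_uminus)

lemma power_q2: "(x :: 'a) ^ q\<^sup>2 = x"
proof (cases "x = 0")
  case False
  \<comment> \<open>Multiplication by \<open>x\<close> permutes the nonzero elements; cancelling
    their product gives Lagrange's identity for the multiplicative group.\<close>
  have "(\<Prod>y\<in>UNIV - {0}. x * y) = \<Prod>(UNIV - {0})"
    by (rule prod.reindex_bij_witness[of _ "\<lambda>y. y / x" "\<lambda>y. x * y"]) (use False in auto)
  then have "x ^ (q\<^sup>2 - 1) = 1"
    by (simp add: prod.distrib card_field)
  moreover have "q\<^sup>2 = Suc (q\<^sup>2 - 1)"
    using q_ge_2 by simp
  ultimately show ?thesis
    by (metis power_Suc mult.right_neutral)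
qed (use q_ge_2 in simp)

lemma conj_conj [simp]: "((x :: 'a) ^ q) ^ q = x"
  using power_q2[of x] by (simp add: power_mult[symmetric] power2_eq_square)

lemma conj_eq_0_iff [simp]: "(x :: 'a) ^ q = 0 \<longleftrightarrow> x = 0"
  using q_ge_2 by simp

text \<open>The trace takes values in the fixed elements of conjugation, of which there are at most
  q, and each fibre is the root set of a monic polynomial of degree q. Since the field has q * q
  elements, every bound is attained.\<close>

lemma card_trace_fibre:
  assumes "(c :: 'a) ^ q = c"
  shows "card {t. t + t ^ q = c} = q"
proof -
  let ?Y = "{y :: 'a. y ^ q = y}"
  have "card {t \<in> UNIV. t + t ^ q = c} = q"
  proof (rule card_fibre_eq_of_card_le)
    show "range (\<lambda>t. t + t ^ q) \<subseteq> ?Y"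
      by (auto simp: conj_add)
    show "card {t \<in> UNIV. t + t ^ q = y} \<le> q" for y :: 'a
    proof -
      have "{t \<in> UNIV. t + t ^ q = y} = {t. t ^ q + poly [:- y, 1:] t = 0}"
        by (auto simp: algebra_simps)
      then show ?thesis
        using card_roots_monic_le[of "[:- y, 1:]" q] q_ge_2 by simp
    qed
    have "?Y = {t. t ^ q + poly [:0, - 1:] t = 0}"
      by auto
    then show "card ?Y \<le> q"
      using card_roots_monic_le[of "[:0, - 1 :: 'a:]" q] q_ge_2 by simp
    show "CARD('a) = q * q"
      by (simp add: card_field power2_eq_square)
  qed (use assms in auto)
  then show ?thesis
    by simp
qed

lemma card_norm_fibre:
  assumes "(c :: 'a) ^ q = c" and "c \<noteq> 0"
  shows "card {t. t ^ (q + 1) = c} = q + 1"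
proof -
  \<comment> \<open>These are the nonzero fixed elements. Writing them as roots of a polynomial of
    degree q - 1 rather than q gives the sharp bound, so that (q - 1) * (q + 1) matches the number
    of nonzero elements.\<close>
  let ?Y = "{y :: 'a. y ^ (q - 1) = 1}"
  have conj_fixed: "y ^ (q - 1) = 1 \<longleftrightarrow> y ^ q = y" if "y \<noteq> 0" for y :: 'a
  proof -
    have "y ^ q = y * y ^ (q - 1)"
      using q_ge_2 by (cases q) auto
    then show ?thesis
      using that by simp
  qed
  have "card {t \<in> - {0}. t ^ (q + 1) = c} = q + 1"
  proof (rule card_fibre_eq_of_card_le)
    show "(\<lambda>t. t ^ (q + 1)) ` (- {0}) \<subseteq> ?Y"
    proof safe
      fix t :: 'a assume "t \<noteq> 0"
      then show "(t ^ (q + 1)) ^ (q - 1) = 1"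
        using conj_fixed[of "t ^ (q + 1)"] by (simp add: power_mult_distrib mult.commute)
    qed
    show "card {t \<in> - {0}. t ^ (q + 1) = y} \<le> q + 1" for y :: 'a
    proof -
      have "card {t. t ^ (q + 1) + poly [:- y:] t = 0} \<le> q + 1"
        by (rule card_roots_monic_le) simp
      then show ?thesis
        by (rule order_trans[rotated]) (auto intro: card_mono)
    qed
    have "?Y = {t. t ^ (q - 1) + poly [:- 1:] t = 0}"
      by auto
    then show "card ?Y \<le> q - 1"
      using card_roots_monic_le[of "[:- 1 :: 'a:]" "q - 1"] q_ge_2 by simp
    show "card (- {0 :: 'a}) = (q - 1) * (q + 1)"
      by (simp add: Compl_eq_Diff_UNIV card_field power2_eq_square algebra_simps)
  qed (use assms conj_fixed in auto)
  moreover have "{t \<in> - {0}. t ^ (q + 1) = c} = {t. t ^ (q + 1) = c}"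
    using assms(2) by auto
  ultimately show ?thesis
    by simp
qed

text \<open>Multiplying the hermitian equation by \<open>\<gamma>\<close> turns it into a norm
  equation in \<open>\<gamma> * t + \<beta>\<close>, whose right-hand side is the
  discriminant.\<close>

lemma complete_square:
  fixes \<alpha> \<beta> \<gamma> t :: 'a
  assumes "\<gamma> ^ q = \<gamma>"
  shows "(\<gamma> * t + \<beta>) ^ (q + 1)
    = \<gamma> * (\<alpha> + \<beta> * t ^ q + \<beta> ^ q * t + \<gamma> * t ^ (q + 1)) + (\<beta> ^ (q + 1) - \<alpha> * \<gamma>)"
  using assms by (simp add: conj_add power_mult_distrib algebra_simps)

lemma affine_preimage:
  fixes \<beta> \<gamma> :: 'a
  assumes "\<gamma> \<noteq> 0"
  shows "card {t. P (\<gamma> * t + \<beta>)} = card {s. P s}"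
proof -
  have "bij_betw (\<lambda>t. \<gamma> * t + \<beta>) {t. P (\<gamma> * t + \<beta>)} {s. P s}"
    by (rule bij_betw_byWitness[of _ "\<lambda>s. (s - \<beta>) / \<gamma>"]) (use assms in auto)
  then show ?thesis
    by (rule bij_betw_same_card)
qed

text \<open>The left-hand side is the value of a hermitian form at u + t v. For
  \<open>\<gamma> = 0\<close> it is a trace equation with q solutions; otherwise it becomes a norm
  equation with q + 1 solutions. The stated bound covers both cases.\<close>

lemma card_hermitian_equation:
  fixes \<alpha> \<beta> \<gamma> :: 'a
  assumes "\<alpha> ^ q = \<alpha>" and "\<gamma> ^ q = \<gamma>" and nondeg: "\<alpha> * \<gamma> \<noteq> \<beta> ^ (q + 1)"
  shows "q \<le> card {t. \<alpha> + \<beta> * t ^ q + \<beta> ^ q * t + \<gamma> * t ^ (q + 1) = 0}"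
proof (cases "\<gamma> = 0")
  case True
  with nondeg have "\<beta> ^ q \<noteq> 0"
    by simp
  have "{t. \<alpha> + \<beta> * t ^ q + \<beta> ^ q * t + \<gamma> * t ^ (q + 1) = 0}
      = {t. (\<beta> ^ q * t + 0) + (\<beta> ^ q * t + 0) ^ q = - \<alpha>}"
    by (auto simp: True power_mult_distrib algebra_simps eq_neg_iff_add_eq_0)
  then show ?thesis
    using affine_preimage[OF \<open>\<beta> ^ q \<noteq> 0\<close>, of "\<lambda>s. s + s ^ q = - \<alpha>" 0]
      card_trace_fibre[of "- \<alpha>"] assms(1) by (simp add: conj_uminus)
next
  case False
  let ?c = "\<beta> ^ (q + 1) - \<alpha> * \<gamma>"
  have "{t. \<alpha> + \<beta> * t ^ q + \<beta> ^ q * t + \<gamma> * t ^ (q + 1) = 0} = {t. (\<gamma> * t + \<beta>) ^ (q + 1) = ?c}"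
    using False complete_square[OF assms(2), of _ \<beta> \<alpha>] by auto
  moreover have "?c ^ q = ?c"
    using assms(1,2) by (simp add: conj_diff power_mult_distrib mult.commute)
  ultimately show ?thesis
    using affine_preimage[OF False, of "\<lambda>s. s ^ (q + 1) = ?c" \<beta>] card_norm_fibre[of ?c] nondeg
    by simp
qed

lemma hermitian_equation_solvable:
  fixes \<alpha> \<beta> \<gamma> :: 'a
  assumes "\<alpha> ^ q = \<alpha>" and "\<gamma> ^ q = \<gamma>" and "\<gamma> \<noteq> 0"
  shows "\<exists>t. \<alpha> + \<beta> * t ^ q + \<beta> ^ q * t + \<gamma> * t ^ (q + 1) = 0"
proof (cases "\<alpha> * \<gamma> = \<beta> ^ (q + 1)")
  case True
  \<comment> \<open>With zero discriminant the norm of \<open>\<gamma> * t + \<beta>\<close> has to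
    vanish, which forces this solution.\<close>
  have "\<gamma> * (- \<beta> / \<gamma>) + \<beta> = 0"
    using assms(3) by simp
  then have "\<gamma> * (\<alpha> + \<beta> * (- \<beta> / \<gamma>) ^ q + \<beta> ^ q * (- \<beta> / \<gamma>) + \<gamma> * (- \<beta> / \<gamma>) ^ (q + 1)) = 0"
    using complete_square[OF assms(2), of "- \<beta> / \<gamma>" \<beta> \<alpha>] True by simp
  then show ?thesis
    using assms(3) by (metis mult_eq_0_iff)
next
  case False
  then have "0 < card {t. \<alpha> + \<beta> * t ^ q + \<beta> ^ q * t + \<gamma> * t ^ (q + 1) = 0}"
    using card_hermitian_equation[OF assms(1,2)] q_ge_2 by fastforce
  then show ?thesis
    by (auto simp: card_gt_0_iff)
qed

text \<open>The kernel of the trace has q > 1 elements. Scaling by such an element turns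
  skew-hermitian forms into hermitian ones.\<close>

lemma exists_skew: "\<exists>l :: 'a. l \<noteq> 0 \<and> l ^ q = - l"
proof -
  have "1 < card {t :: 'a. t + t ^ q = 0}"
    using card_trace_fibre[of 0] q_ge_2 by simp
  then have "\<not> {t :: 'a. t + t ^ q = 0} \<subseteq> {0}"
    by (metis (no_types) One_nat_def card.empty card.insert card_mono empty_iff finite.emptyI finite.insertI not_less)
  then show ?thesis
    by (auto simp: eq_neg_iff_add_eq_0 add.commute)
qed

end

section \<open>Totally isotropic lines\<close>

text \<open>The negation of the disjointness condition in \<open>partial_spread\<close>. A line
  meets itself, so lines that do not meet are in particular distinct.\<close>

definition meets :: "('a::{field,finite} ^ 4) set \<Rightarrow> ('a ^ 4) set \<Rightarrow> bool" where
  "meets U W \<longleftrightarrow> U \<inter> W \<noteq> {0}"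

lemma span_pair:
  "vec.span {a, b :: 'a::field ^ 'n} = {s *s a + t *s b | s t. True}"
proof -
  have "x \<in> vec.span {a, b} \<longleftrightarrow> (\<exists>s t. x = s *s a + t *s b)" for x
    by (simp add: vec.span_breakdown_eq diff_diff_eq)
  then show ?thesis
    by blast
qed

lemma dim_span_pair:
  fixes a b :: "'a::field ^ 'n"
  assumes "a \<noteq> 0" and "b \<notin> vec.span {a}"
  shows "vec.dim (vec.span {a, b}) = 2"
  using assms by (subst insert_commute) (simp add: vec.dim_insert)

lemma dim2_basis:
  fixes U :: "('a::field ^ 'n) set"
  assumes "vec.subspace U" and "vec.dim U = 2" and "a \<in> U" and "a \<noteq> 0"
  obtains b where "b \<in> U" and "b \<notin> vec.span {a}" and "U = vec.span {a, b}"
proof -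
  have "\<not> U \<subseteq> vec.span {a}"
  proof
    assume "U \<subseteq> vec.span {a}"
    then have "vec.dim U \<le> card {a}"
      by (rule vec.dim_le_card) simp
    then show False
      using assms(2) by simp
  qed
  then obtain b where b: "b \<in> U" "b \<notin> vec.span {a}"
    by blast
  have "vec.span {a, b} \<subseteq> U"
    using assms(1,3) b(1) by (simp add: vec.span_minimal)
  then have "U = vec.span {a, b}"
    using vec.subspace_dim_equal[of "vec.span {a, b}" U] assms dim_span_pair[OF assms(4) b(2)] by simp
  then show thesis
    using that b by blast
qed

lemma dim2_eq_span:
  fixes U :: "('a::field ^ 'n) set"
  assumes "vec.subspace U" and "vec.dim U = 2" and "a \<in> U" and "b \<in> U"
    and "a \<noteq> 0" and "b \<notin> vec.span {a}"
  shows "U = vec.span {a, b}"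
  using vec.subspace_dim_equal[of "vec.span {a, b}" U] assms dim_span_pair[of a b]
  by (simp add: vec.span_minimal)

lemma span_eq_UNIV_of_dim:
  fixes S :: "('a::field ^ 'n) set"
  assumes "CARD('n) \<le> vec.dim S"
  shows "vec.span S = UNIV"
proof -
  have "vec.dim S = CARD('n)"
    using assms vec.dim_subset[of S UNIV] by (simp add: vec_dim_card card_cart_basis)
  then show ?thesis
    using vec.dim_eq_full[of S] by (simp add: vec.dimension_def card_cart_basis)
qed

locale hermitian_space = quadratic_finite_field q F
  for q :: nat and F :: "'a::{field,finite} itself" +
  fixes h :: "'a ^ 4 \<Rightarrow> 'a ^ 4 \<Rightarrow> 'a"
  assumes form: "hermitian_form q h"
    and nondeg: "nondegenerate h"
begin

lemma h_conj: "h y x = h x y ^ q"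
  using form unfolding hermitian_form_def by blast

lemma h_add_left: "h (x + y) z = h x z + h y z"
  using form unfolding hermitian_form_def by blast

lemma h_scale_left: "h (c *s x) y = c * h x y"
  using form unfolding hermitian_form_def by blast

lemma h_add_right: "h z (x + y) = h z x + h z y"
  by (metis h_conj h_add_left conj_add)

lemma h_scale_right: "h y (c *s x) = c ^ q * h y x"
  by (metis h_conj h_scale_left power_mult_distrib)

lemmas h_simps = h_add_left h_scale_left h_add_right h_scale_right

lemma h_zero_left [simp]: "h 0 x = 0"
  using h_scale_left[of 0 0 x] by simp

lemma h_zero_right [simp]: "h x 0 = 0"
  using h_scale_right[of x 0 0] by simp

lemma h_sym_0: "h x y = 0 \<longleftrightarrow> h y x = 0"
  by (metis h_conj conj_eq_0_iff)

lemma h_self_conj: "h x x ^ q = h x x"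
  using h_conj[of x x] by simp

lemma h_diff_left: "h (x - y) z = h x z - h y z"
  using h_add_left[of "x - y" y z] by (simp add: eq_diff_eq)

lemma subspace_perp: "vec.subspace {y. h x y = 0}"
  unfolding vec.subspace_def by (auto simp: h_simps)

lemma subspace_perp_left: "vec.subspace {y. h y x = 0}"
  unfolding vec.subspace_def by (auto simp: h_simps)

lemma perp_span:
  assumes "\<And>y. y \<in> S \<Longrightarrow> h x y = 0" and "y \<in> vec.span S"
  shows "h x y = 0"
  using vec.span_minimal[OF _ subspace_perp, of S x] assms by auto

lemma eq_0_if_perp_spanning:
  assumes "\<And>y. y \<in> S \<Longrightarrow> h x y = 0" and "vec.span S = UNIV"
  shows "x = 0"
  using nondeg perp_span[OF assms(1)] assms(2) unfolding nondegenerate_def by auto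

lemma h_expand:
  "h (u + t *s v) (u + t *s v) = h u u + h u v * t ^ q + h u v ^ q * t + h v v * t ^ (q + 1)"
  using h_conj[of u v] by (simp add: h_simps algebra_simps)

lemma totally_isotropic_span:
  assumes "\<And>x y. x \<in> S \<Longrightarrow> y \<in> S \<Longrightarrow> h x y = 0"
  shows "totally_isotropic h (vec.span S)"
proof -
  have "h x y = 0" if "x \<in> S" "y \<in> vec.span S" for x y
    using perp_span that assms by blast
  then have "h x y = 0" if "x \<in> vec.span S" "y \<in> vec.span S" for x y
    using perp_span h_sym_0 that by metis
  then show ?thesis
    unfolding totally_isotropic_def by blast
qed

abbreviation lines :: "('a ^ 4) set set" where
  "lines \<equiv> polar_lines h"

lemma lineD:
  assumes "U \<in> lines"
  shows "vec.subspace U" and "vec.dim U = 2" and "x \<in> U \<Longrightarrow> y \<in> U \<Longrightarrow> h x y = 0"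
  using assms unfolding polar_lines_def polar_space_def totally_isotropic_def by auto

lemma zero_in_line: "U \<in> lines \<Longrightarrow> 0 \<in> U"
  using lineD(1) vec.subspace_0 by blast

lemma line_nonzero:
  assumes "U \<in> lines"
  obtains x where "x \<in> U" and "x \<noteq> 0"
proof -
  have "\<not> U \<subseteq> {0}"
    using lineD(2)[OF assms] vec.dim_eq_0[of U] by auto
  then show thesis
    using that by blast
qed

lemma span_pair_line:
  assumes "a \<noteq> 0" and "b \<notin> vec.span {a}" and "h a a = 0" and "h b b = 0" and "h a b = 0"
  shows "vec.span {a, b} \<in> lines"
  unfolding polar_lines_def polar_space_def
  using dim_span_pair[OF assms(1,2)] totally_isotropic_span[of "{a, b}"] assms h_sym_0 by auto

lemma line_basis:
  assumes "U \<in> lines" and "a \<in> U" and "a \<noteq> 0"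
  obtains b where "b \<in> U" and "b \<notin> vec.span {a}" and "U = vec.span {a, b}"
  using dim2_basis[OF lineD(1,2)[OF assms(1)] assms(2,3)] by blast

lemma line_eq_span:
  assumes "U \<in> lines" and "a \<in> U" and "b \<in> U" and "a \<noteq> 0" and "b \<notin> vec.span {a}"
  shows "U = vec.span {a, b}"
  using dim2_eq_span[OF lineD(1,2)[OF assms(1)]] assms by blast

lemma line_closed:
  assumes "U \<in> lines" and "a \<in> U" and "b \<in> vec.span {a}"
  shows "b \<in> U"
  using vec.span_minimal[of "{a}" U] lineD(1)[OF assms(1)] assms(2,3) by blast

lemma meetsE:
  assumes "meets U V" and "U \<in> lines" and "V \<in> lines"
  obtains x where "x \<in> U" and "x \<in> V" and "x \<noteq> 0"
  using assms zero_in_line unfolding meets_def by blast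

lemma meets_commute: "meets U V \<longleftrightarrow> meets V U"
  unfolding meets_def by blast

lemma meetsI: "x \<in> U \<Longrightarrow> x \<in> V \<Longrightarrow> x \<noteq> 0 \<Longrightarrow> meets U V"
  unfolding meets_def by blast

lemma meets_self:
  assumes "U \<in> lines"
  shows "meets U U"
  using line_nonzero[OF assms] meetsI by blast

text \<open>A totally isotropic subspace of dimension 3 would contain, for any vector
  \<open>d\<close> outside it, a nonzero vector orthogonal to \<open>d\<close> as well, hence to the
  whole space, against nondegeneracy.\<close>

lemma isotropic_triple_dependent:
  assumes "a \<noteq> 0" and "b \<notin> vec.span {a}"
    and "h a a = 0" and "h b b = 0" and "h c c = 0" and "h a b = 0" and "h a c = 0" and "h b c = 0"
  shows "c \<in> vec.span {a, b}"
proof (rule ccontr)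
  assume c: "c \<notin> vec.span {a, b}"
  have "vec.dim {c, a, b} = 3"
    using c dim_span_pair[OF assms(1,2)] by (simp add: vec.dim_insert[of c])
  then have "vec.span {c, a, b} \<noteq> UNIV"
    using vec.dim_span[of "{c, a, b}"] vec_dim_card[where ?'a = 'a and ?'n = 4] by fastforce
  then obtain d where d: "d \<notin> vec.span {c, a, b}"
    by blast
  then have "vec.dim {d, c, a, b} = 4"
    using \<open>vec.dim {c, a, b} = 3\<close> by (simp add: vec.dim_insert[of d])
  then have span: "vec.span {d, c, a, b} = UNIV"
    by (intro span_eq_UNIV_of_dim) simp
  \<comment> \<open>A combination of \<open>a\<close> and \<open>b\<close> chosen to be orthogonal
    to \<open>d\<close>; it is orthogonal to \<open>a\<close>, \<open>b\<close> and \<open>c\<close>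
    anyway.\<close>
  define r where "r = (if h a d = 0 then a else h b d *s a - h a d *s b)"
  have "h r y = 0" if "y \<in> {d, c, a, b}" for y
    using that assms h_sym_0[of a b] by (auto simp: r_def h_diff_left h_scale_left)
  then have "r = 0"
    using eq_0_if_perp_spanning span by blast
  have "b \<in> vec.span {a}" if "h a d \<noteq> 0" "h b d *s a = h a d *s b"
  proof -
    have "b = (h b d / h a d) *s a"
      using that by (metis divide_inverse_commute left_inverse vector_smult_assoc vector_smult_lid)
    then show ?thesis
      by (metis vec.span_base vec.span_scale singletonI)
  qed
  then show False
    using \<open>r = 0\<close> assms(1,2) by (auto simp: r_def split: if_splits)
qed

text \<open>The absence of triangles in a generalized quadrangle. The three pairwise common points
  are isotropic and mutually orthogonal, so if those on \<open>V\<close> are distinct, the third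
  lies on \<open>V\<close> too.\<close>

lemma triangle_concurrent:
  assumes "U \<in> lines" and "V \<in> lines" and "W \<in> lines"
    and "meets U V" and "meets V W" and "meets U W"
  obtains x where "x \<in> U" and "x \<in> V" and "x \<in> W" and "x \<noteq> 0"
proof -
  obtain a where a: "a \<in> U" "a \<in> V" "a \<noteq> 0"
    using meetsE assms by metis
  obtain b where b: "b \<in> V" "b \<in> W" "b \<noteq> 0"
    using meetsE assms by metis
  obtain c where c: "c \<in> U" "c \<in> W" "c \<noteq> 0"
    using meetsE assms by metis
  show thesis
  proof (cases "b \<in> vec.span {a}")
    case True
    then have "b \<in> U"
      using line_closed[OF assms(1)] a by blast
    then show thesis
      using that b by blast
  next
    case False
    have "c \<in> vec.span {a, b}"
      using isotropic_triple_dependent[of a b c] False a b c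
        lineD(3)[OF assms(1)] lineD(3)[OF assms(2)] lineD(3)[OF assms(3)] by auto
    then have "c \<in> V"
      using line_eq_span[OF assms(2)] a b False by blast
    then show thesis
      using that c by blast
  qed
qed

text \<open>Distinct lines share at most one projective point, since two would span both lines. The
  inclusion in a third line \<open>W\<close> through that point is the form that combines with
  \<open>triangle_concurrent\<close>.\<close>

lemma common_point_unique:
  assumes "U \<in> lines" and "V \<in> lines" and "U \<noteq> V" and "W \<in> lines"
    and "x \<in> U" and "x \<in> V" and "x \<in> W" and "x \<noteq> 0"
  shows "U \<inter> V \<subseteq> W"
proof
  fix y assume y: "y \<in> U \<inter> V"
  then have "y \<in> vec.span {x}"
    using line_eq_span assms by (metis IntD1 IntD2)
  then show "y \<in> W"
    using assms(7) line_closed[OF assms(4)] by blast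
qed

lemma line_through_point_meeting:
  assumes "M \<in> lines" and "x \<noteq> 0" and "h x x = 0"
  obtains N where "N \<in> lines" and "x \<in> N" and "meets N M"
proof (cases "x \<in> M")
  case True
  then show thesis
    using that assms meetsI by blast
next
  case False
  obtain a where a: "a \<in> M" "a \<noteq> 0"
    using line_nonzero assms(1) by blast
  obtain b where b: "b \<in> M" "b \<notin> vec.span {a}"
    using line_basis[OF assms(1) a] by blast
  \<comment> \<open>The functional \<open>h _ x\<close> has a nonzero kernel on the 2-dimensional
    \<open>M\<close>. The vector \<open>r\<close> lies in it, so it spans a totally isotropic line
    together with \<open>x\<close>.\<close>
  define r where "r = (if h a x = 0 then a else b - (h b x / h a x) *s a)"
  have "r \<in> M"
    using a b lineD(1)[OF assms(1)] by (simp add: r_def vec.subspace_diff vec.subspace_scale)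
  have "r \<noteq> 0"
    using a(2) b(2) by (auto simp: r_def vec.span_singleton)
  have "h r x = 0"
    by (simp add: r_def h_diff_left h_scale_left)
  have "x \<notin> vec.span {r}"
    using False \<open>r \<in> M\<close> line_closed[OF assms(1)] by blast
  then have "vec.span {r, x} \<in> lines"
    using span_pair_line \<open>r \<noteq> 0\<close> \<open>h r x = 0\<close> \<open>r \<in> M\<close> lineD(3)[OF assms(1)] assms(3) by blast
  then show thesis
    using that \<open>r \<noteq> 0\<close> \<open>r \<in> M\<close> meetsI[of r] by (metis insertCI vec.span_base)
qed

text \<open>If everything orthogonal to \<open>x\<close> were orthogonal to \<open>y\<close>, then
  \<open>y\<close> would be a multiple of \<open>x\<close>; the factor \<open>c\<close> is read off
  at a vector \<open>g\<close> not orthogonal to \<open>x\<close>.\<close>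

lemma exists_perp_distinguishing:
  assumes "x \<noteq> 0" and "y \<notin> vec.span {x}"
  obtains f where "h x f = 0" and "h y f \<noteq> 0"
proof (rule ccontr)
  assume "\<not> thesis"
  then have *: "h y f = 0" if "h x f = 0" for f
    using that \<open>\<And>f. h x f = 0 \<Longrightarrow> h y f \<noteq> 0 \<Longrightarrow> thesis\<close> by blast
  obtain g where g: "h x g \<noteq> 0"
    using nondeg assms(1) unfolding nondegenerate_def by blast
  define c where "c = h y g / h x g"
  have "h (y - c *s x) f = 0" for f
  proof -
    \<comment> \<open>Project an arbitrary \<open>f\<close> along \<open>g\<close> into the space
      orthogonal to \<open>x\<close>, where the assumption on \<open>y\<close> applies.\<close>
    have "h x (f - (h f x / h g x) *s g) = 0"
      using g by (subst h_sym_0) (auto simp: h_diff_left h_scale_left h_sym_0[of g x])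
    then have "h y (f - (h f x / h g x) *s g) = 0"
      by (rule *)
    then have "h f y = (h f x / h g x) * h g y"
      by (subst (asm) h_sym_0) (simp add: h_diff_left h_scale_left)
    then have "h y f = h x f / h x g * h y g"
      by (metis h_conj power_divide power_mult_distrib)
    then show ?thesis
      by (simp add: h_diff_left h_scale_left c_def)
  qed
  then have "y = c *s x"
    using nondeg unfolding nondegenerate_def by (metis eq_iff_diff_eq_0)
  then show False
    using assms(2) unfolding vec.span_singleton by blast
qed

end

section \<open>Counting lines\<close>

lemma pair_independent:
  fixes u v :: "'a::field ^ 'n"
  assumes "u \<noteq> 0" and "v \<notin> vec.span {u}" and "s *s u + t *s v = 0"
  shows "s = 0" and "t = 0"
proof -
  show "t = 0"
  proof (rule ccontr)
    assume "t \<noteq> 0"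
    have "t *s v = (- s) *s u"
      using assms(3) by (simp add: eq_neg_iff_add_eq_0 add.commute)
    then have "v = (- s / t) *s u"
      using \<open>t \<noteq> 0\<close> by (metis divide_inverse_commute left_inverse vector_smult_assoc vector_smult_lid)
    then show False
      using assms(2) unfolding vec.span_singleton by blast
  qed
  then show "s = 0"
    using assms(1,3) by simp
qed

text \<open>Serves injectivity of families of lines indexed by \<open>t\<close>: if two parameters
  gave the same line, it would contain both \<open>b\<close> and \<open>x\<close>.\<close>

lemma subspace_direction:
  fixes x b :: "'a::field ^ 'n"
  assumes "vec.subspace S" and "x + s *s b \<in> S" and "x + t *s b \<in> S" and "s \<noteq> t"
  shows "b \<in> S" and "x \<in> S"
proof -
  have "(s - t) *s b \<in> S"
    using vec.subspace_diff[OF assms(1-3)] by (simp add: vector_sub_rdistrib)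
  then have "(1 / (s - t)) *s ((s - t) *s b) \<in> S"
    by (rule vec.subspace_scale[OF assms(1)])
  moreover have "(1 / (s - t)) *s ((s - t) *s b) = b"
    unfolding vector_smult_assoc using assms(4) by simp
  ultimately show "b \<in> S"
    by simp
  then show "x \<in> S"
    using vec.subspace_diff[OF assms(1,2) vec.subspace_scale[OF assms(1)], of b s] by simp
qed

context hermitian_space
begin

text \<open>If \<open>v\<close> is not isotropic, isotropy of u + t v is a hermitian equation with
  nonzero leading coefficient \<open>h v v\<close>, which is solvable.\<close>

lemma exists_isotropic_in_span_pair:
  assumes "u \<noteq> 0" and "v \<notin> vec.span {u}"
  obtains y where "y \<in> vec.span {u, v}" and "y \<noteq> 0" and "h y y = 0"
proof (cases "h v v = 0")
  case True
  then show thesis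
    using that[of v] assms vec.span_base[of v "{u, v}"] vec.span_zero by auto
next
  case False
  obtain t where t: "h (u + t *s v) (u + t *s v) = 0"
    using hermitian_equation_solvable[OF h_self_conj[of u] h_self_conj[of v] False] h_expand by metis
  have "u + t *s v \<in> vec.span {u, v}"
    by (simp add: vec.span_add vec.span_base vec.span_scale)
  moreover have "u + t *s v \<noteq> 0"
    using pair_independent(1)[OF assms, of 1 t] by auto
  ultimately show thesis
    using that t by blast
qed

lemma dim_perp: "3 \<le> vec.dim {y. h y x = 0}"
proof (cases "\<exists>z. h z x \<noteq> 0")
  case True
  then obtain z where z: "h z x \<noteq> 0"
    by blast
  have "y \<in> vec.span (insert z {y. h y x = 0})" for y
  proof -
    have "y - (h y x / h z x) *s z \<in> vec.span {y. h y x = 0}"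
      using z by (intro vec.span_base) (simp add: h_diff_left h_scale_left)
    then show ?thesis
      unfolding vec.span_breakdown_eq[of y z] by blast
  qed
  then have "vec.span (insert z {y. h y x = 0}) = UNIV"
    by auto
  then have "vec.dim (insert z {y. h y x = 0}) = 4"
    using vec.dim_span[of "insert z {y. h y x = 0}"] vec_dim_card[where ?'a = 'a and ?'n = 4] by simp
  then show ?thesis
    by (simp add: vec.dim_insert split: if_splits)
next
  case False
  then have "{y. h y x = 0} = UNIV"
    by auto
  then show ?thesis
    using vec_dim_card[where ?'a = 'a and ?'n = 4] by simp
qed

text \<open>The space orthogonal to an isotropic \<open>x\<close> has dimension at least 3, so it
  contains \<open>y\<close> and \<open>z\<close> independent modulo \<open>x\<close>. An isotropic
  \<open>w\<close> in their span is no multiple of \<open>x\<close> and completes a line.\<close>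

lemma exists_line: "\<exists>U. U \<in> lines"
proof -
  have no_small_span: "\<not> V \<subseteq> vec.span S" if "card S < vec.dim V" "finite S" for V S :: "('a ^ 4) set"
    using vec.dim_le_card[of V S] that by auto
  have dim4: "vec.dim (UNIV :: ('a ^ 4) set) = 4"
    using vec_dim_card[where ?'a = 'a and ?'n = 4] by simp
  obtain u :: "'a ^ 4" where u: "u \<noteq> 0"
    using no_small_span[of "{}" UNIV] dim4 by auto
  obtain v where v: "v \<notin> vec.span {u}"
    using no_small_span[of "{u}" UNIV] dim4 by auto
  obtain x where x: "x \<noteq> 0" "h x x = 0"
    using exists_isotropic_in_span_pair[OF u v] by blast
  have "card {x} < vec.dim {y. h y x = 0}"
    using dim_perp[of x] by simp
  then obtain y where y: "h y x = 0" "y \<notin> vec.span {x}"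
    using no_small_span[of "{x}" "{y. h y x = 0}"] by auto
  have "card {x, y} < vec.dim {y. h y x = 0}"
    using dim_perp[of x] by (cases "x = y") simp_all
  then obtain z where z: "h z x = 0" "z \<notin> vec.span {x, y}"
    using no_small_span[of "{x, y}" "{y. h y x = 0}"] by auto
  have "y \<noteq> 0"
    using y(2) vec.span_zero by auto
  moreover have "z \<notin> vec.span {y}"
    using z(2) vec.span_mono[of "{y}" "{x, y}"] by auto
  ultimately obtain w where w: "w \<in> vec.span {y, z}" "w \<noteq> 0" "h w w = 0"
    using exists_isotropic_in_span_pair by blast
  have "h w x = 0"
    using vec.span_minimal[OF _ subspace_perp_left[of x], of "{y, z}"] w(1) y(1) z(1) by auto
  have "w \<notin> vec.span {x}"
  proof
    assume "w \<in> vec.span {x}"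
    then obtain k where "w = k *s x"
      unfolding vec.span_singleton by blast
    obtain s t where st: "w = s *s y + t *s z"
      using w(1) unfolding span_pair by blast
    have k: "k *s x = s *s y + t *s z"
      using st \<open>w = k *s x\<close> by simp
    have "t *s z = k *s x - s *s y"
      using k by (simp add: algebra_simps)
    have "t = 0"
    proof (rule ccontr)
      assume "t \<noteq> 0"
      then have "z = (1 / t) *s (k *s x - s *s y)"
        by (simp add: \<open>t *s z = k *s x - s *s y\<close>[symmetric])
      then show False
        using z(2) by (simp add: vec.span_base vec.span_diff vec.span_scale)
    qed
    then have "(- k) *s x + s *s y = 0"
      using k by simp
    then have "s = 0"
      using pair_independent(2)[OF x(1) y(2)] by blast
    then show False
      using st \<open>t = 0\<close> w(2) by simp
  qed
  then show ?thesis
    using span_pair_line[OF x(1)] x(2) w(3) \<open>h w x = 0\<close> h_sym_0 by blast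
qed

text \<open>Choose \<open>f\<close> orthogonal to \<open>x\<close> but not to a second vector
  \<open>v\<close> of \<open>U\<close>. Each isotropic f + t v spans a line with \<open>x\<close>.
  As \<open>v\<close> is isotropic and not orthogonal to \<open>f\<close>, the equation for
  \<open>t\<close> is nondegenerate. Equal lines for different \<open>t\<close> would contain
  \<open>v\<close>, which is not orthogonal to f + t v.\<close>

lemma card_lines_through_point:
  assumes "U \<in> lines" and "x \<in> U" and "x \<noteq> 0"
  shows "q \<le> card {N \<in> lines. x \<in> N \<and> N \<noteq> U}"
proof -
  obtain v where v: "v \<in> U" "v \<notin> vec.span {x}" "U = vec.span {x, v}"
    using line_basis[OF assms] by blast
  have iso: "h x x = 0" "h v v = 0" "h x v = 0"
    using lineD(3)[OF assms(1)] assms(2) v(1) by auto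
  obtain f where f: "h x f = 0" "h v f \<noteq> 0"
    using exists_perp_distinguishing[OF assms(3) v(2)] by blast
  then have "h f v \<noteq> 0"
    using h_sym_0 by blast
  define T where "T = {t. h (f + t *s v) (f + t *s v) = 0}"
  define N where "N t = vec.span {x, f + t *s v}" for t
  have v_f: "h v (f + t *s v) \<noteq> 0" for t
    using f(2) iso(2) by (simp add: h_simps)
  have notin: "f + t *s v \<notin> vec.span {x}" for t
  proof
    assume "f + t *s v \<in> vec.span {x}"
    then obtain k where "f + t *s v = k *s x"
      unfolding vec.span_singleton by blast
    then show False
      using v_f[of t] iso(3) h_sym_0[of x v] by (simp add: h_scale_right)
  qed
  have in_N: "x \<in> N t" "f + t *s v \<in> N t" for t
    by (simp_all add: N_def vec.span_base)
  have line_N: "N t \<in> lines" if "t \<in> T" for t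
    unfolding N_def
    by (rule span_pair_line) (use that assms(3) notin iso f(1) in \<open>auto simp: T_def h_simps\<close>)
  have v_notin: "v \<notin> N t" if "t \<in> T" for t
    using lineD(3)[OF line_N[OF that]] in_N v_f by blast
  have "inj_on N T"
  proof (rule inj_onI, rule ccontr)
    fix t t' assume t: "t \<in> T" "t' \<in> T" "N t = N t'" "t \<noteq> t'"
    then have "v \<in> N t"
      using subspace_direction(1)[OF lineD(1)[OF line_N[OF t(1)]] in_N(2)[of t], of t'] in_N(2)[of t']
      by simp
    then show False
      using v_notin t(1) by blast
  qed
  moreover have "N ` T \<subseteq> {N \<in> lines. x \<in> N \<and> N \<noteq> U}"
    using line_N in_N(1) v(1) v_notin by blast
  ultimately have "card T \<le> card {N \<in> lines. x \<in> N \<and> N \<noteq> U}"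
    by (intro card_inj_on_le) auto
  moreover have "q \<le> card T"
    unfolding T_def h_expand
    by (rule card_hermitian_equation) (use \<open>h f v \<noteq> 0\<close> iso(2) h_self_conj in auto)
  ultimately show ?thesis
    by simp
qed

lemma exists_other_line_through_point:
  assumes "U \<in> lines" and "x \<in> U" and "x \<noteq> 0"
  obtains N where "N \<in> lines" and "x \<in> N" and "N \<noteq> U"
proof -
  have "{N \<in> lines. x \<in> N \<and> N \<noteq> U} \<noteq> {}"
    using card_lines_through_point[OF assms] q_ge_2 by (metis card.empty not_numeral_le_zero order_trans)
  then show thesis
    using that by blast
qed

text \<open>Take a path \<open>U\<close>, \<open>N\<close>, \<open>W\<close> of lines through
  different points \<open>x\<close> and \<open>y\<close> of \<open>N\<close>. If \<open>U\<close>
  met \<open>W\<close>, the triangle would be concurrent at \<open>y\<close>, so \<open>U\<close>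
  and \<open>N\<close> would share two points.\<close>

lemma exists_opposite_lines:
  obtains U W where "U \<in> lines" and "W \<in> lines" and "\<not> meets U W"
proof -
  obtain U where U: "U \<in> lines"
    using exists_line by blast
  obtain x where x: "x \<in> U" "x \<noteq> 0"
    using line_nonzero[OF U] by blast
  obtain N where N: "N \<in> lines" "x \<in> N" "N \<noteq> U"
    using exists_other_line_through_point[OF U x] by blast
  obtain y where y: "y \<in> N" "y \<notin> vec.span {x}"
    using line_basis[OF N(1,2) x(2)] by blast
  then have "y \<noteq> 0"
    using vec.span_zero by auto
  then obtain W where W: "W \<in> lines" "y \<in> W" "W \<noteq> N"
    using exists_other_line_through_point[OF N(1) y(1)] by blast
  have "\<not> meets U W"
  proof
    assume "meets U W"
    then obtain z where z: "z \<in> U" "z \<in> N" "z \<in> W" "z \<noteq> 0"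
      using triangle_concurrent[OF U N(1) W(1)] meetsI N(2) W(2) x y(1) \<open>y \<noteq> 0\<close> by metis
    then have "y \<in> U"
      using common_point_unique[OF N(1) W(1) _ U, of z] W(2,3) y(1) by blast
    then show False
      using line_eq_span[OF U x(1) _ x(2) y(2)] line_eq_span[OF N(1,2) y(1) x(2) y(2)] N(3) by simp
  qed
  then show thesis
    using that U W(1) by blast
qed

end

section \<open>Two opposite lines and their transversals\<close>

locale opposite_lines = hermitian_space +
  fixes l m :: "('a ^ 4) set"
  assumes l: "l \<in> polar_lines h" and m: "m \<in> polar_lines h" and opposite: "\<not> meets l m"
begin

definition transversals :: "('a ^ 4) set set" where
  "transversals = {L \<in> lines. meets L l \<and> meets L m}"

lemma transversalD:
  assumes "L \<in> transversals"
  shows "L \<in> lines" and "meets L l" and "meets L m" and "L \<noteq> l" and "L \<noteq> m"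
  using assms opposite meets_commute[of m l] unfolding transversals_def by auto

lemma opposite_zero: "x \<in> l \<Longrightarrow> x \<in> m \<Longrightarrow> x = 0"
  using opposite meetsI by blast

text \<open>If two transversals met, the triangles they form with \<open>l\<close> and with
  \<open>m\<close> would place their single common point on both \<open>l\<close> and
  \<open>m\<close>.\<close>

lemma transversals_disjoint:
  assumes "L \<in> transversals" and "L' \<in> transversals" and "L \<noteq> L'"
  shows "\<not> meets L L'"
proof
  note L = transversalD[OF assms(1)] and L' = transversalD[OF assms(2)]
  assume "meets L L'"
  obtain x where x: "x \<in> L" "x \<in> L'" "x \<in> l" "x \<noteq> 0"
    using triangle_concurrent[OF L(1) L'(1) l \<open>meets L L'\<close> L'(2) L(2)] by blast
  obtain y where y: "y \<in> L" "y \<in> L'" "y \<in> m" "y \<noteq> 0"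
    using triangle_concurrent[OF L(1) L'(1) m \<open>meets L L'\<close> L'(3) L(3)] by blast
  have "y \<in> l"
    using common_point_unique[OF L(1) L'(1) assms(3) l x(1,2,3,4)] y by blast
  then show False
    using y opposite_zero by blast
qed

lemma transversal_through_point:
  assumes "x \<in> l" and "x \<noteq> 0"
  obtains L where "L \<in> transversals" and "x \<in> L"
proof -
  have "h x x = 0"
    using lineD(3)[OF l] assms by blast
  then obtain L where "L \<in> lines" "x \<in> L" "meets L m"
    using line_through_point_meeting[OF m assms(2)] by blast
  then show thesis
    using that meetsI assms unfolding transversals_def by blast
qed

text \<open>Transversals correspond to the points of \<open>l\<close>: each point lies on one,
  unique by disjointness, and a transversal through two points of \<open>l\<close> would be
  \<open>l\<close>.\<close>

lemma card_transversals: "card transversals = q\<^sup>2 + 1"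
proof -
  obtain a where a: "a \<in> l" "a \<noteq> 0"
    using line_nonzero[OF l] by blast
  obtain b where b: "b \<in> l" "b \<notin> vec.span {a}" "l = vec.span {a, b}"
    using line_basis[OF l a] by blast
  have "b \<noteq> 0"
    using b(2) vec.span_zero by auto
  \<comment> \<open>One representative for each projective point of \<open>l\<close>, with
    \<open>None\<close> as the point at infinity.\<close>
  define p where "p i = (case i of None \<Rightarrow> b | Some t \<Rightarrow> a + t *s b)" for i
  have p_in: "p i \<in> l" for i
    unfolding p_def b(3) by (auto split: option.split intro: vec.span_add vec.span_scale vec.span_base)
  have p_nz: "p i \<noteq> 0" for i
    using pair_independent(1)[OF a(2) b(2), of 1] \<open>b \<noteq> 0\<close> unfolding p_def
    by (auto split: option.split)
  have "\<forall>i. \<exists>L. L \<in> transversals \<and> p i \<in> L"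
    using transversal_through_point p_in p_nz by metis
  then obtain L where L: "\<And>i. L i \<in> transversals" "\<And>i. p i \<in> L i"
    by metis
  have "inj L"
  proof (rule injI, rule ccontr)
    fix i j assume ij: "L i = L j" "i \<noteq> j"
    have sub: "vec.subspace (L i)"
      using transversalD(1)[OF L(1)] lineD(1) by blast
    have "b \<in> L i \<and> a \<in> L i"
    proof (cases i)
      case None
      then obtain t where t: "j = Some t"
        using ij(2) by (cases j) auto
      have "b \<in> L i" "a + t *s b \<in> L i"
        using L(2)[of i] L(2)[of j] None t ij(1) by (auto simp: p_def)
      then show ?thesis
        using vec.subspace_diff[OF sub, of "a + t *s b" "t *s b"] vec.subspace_scale[OF sub] by simp
    next
      case (Some s)
      have *: "a + s *s b \<in> L i"
        using L(2)[of i] Some by (simp add: p_def)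
      have "b \<in> L i"
      proof (cases j)
        case None
        then show ?thesis
          using L(2)[of j] ij(1) by (simp add: p_def)
      next
        case (Some t)
        then have "s \<noteq> t"
          using ij(2) \<open>i = Some s\<close> by simp
        have "a + t *s b \<in> L i"
          using L(2)[of j] ij(1) Some by (simp add: p_def)
        then show ?thesis
          using subspace_direction(1)[OF sub *] \<open>s \<noteq> t\<close> by blast
      qed
      then show ?thesis
        using vec.subspace_diff[OF sub *, of "s *s b"] vec.subspace_scale[OF sub] by simp
    qed
    then have "L i = l"
      using line_eq_span[OF transversalD(1)[OF L(1)] _ _ a(2) b(2)] b(3) by blast
    then show False
      using transversalD(4)[OF L(1)] by blast
  qed
  moreover have "range L = transversals"
  proof (intro equalityI subsetI)
    fix N assume N: "N \<in> transversals"
    have sub: "vec.subspace N"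
      using transversalD(1)[OF N] lineD(1) by blast
    obtain x where x: "x \<in> N" "x \<in> l" "x \<noteq> 0"
      using meetsE[OF transversalD(2,1)[OF N] l] by blast
    obtain s t where st: "x = s *s a + t *s b"
      using x(2) unfolding b(3) span_pair by blast
    have "\<exists>i. p i \<in> N"
    proof (cases "s = 0")
      case True
      then have "t \<noteq> 0"
        using st x(3) by auto
      then have "b = (1 / t) *s x"
        using st True by simp
      then have "p None \<in> N"
        using vec.subspace_scale[OF sub x(1)] by (simp add: p_def)
      then show ?thesis
        by blast
    next
      case False
      then have "a + (t / s) *s b = (1 / s) *s x"
        unfolding st by (simp add: vector_add_ldistrib)
      then have "p (Some (t / s)) \<in> N"
        using vec.subspace_scale[OF sub x(1)] by (simp add: p_def)
      then show ?thesis
        by blast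
    qed
    then obtain i where "p i \<in> N"
      by blast
    then have "N = L i"
      using transversals_disjoint[OF N L(1)[of i]] meetsI L(2) p_nz by blast
    then show "N \<in> range L"
      by blast
  qed (use L(1) in auto)
  ultimately have "card transversals = CARD('a option)"
    using card_image[of L UNIV] by simp
  then show ?thesis
    by (simp add: card_UNIV_option card_field)
qed

lemma decompose:
  obtains y z where "y \<in> l" and "z \<in> m" and "x = y + z"
proof -
  obtain a where a: "a \<in> l" "a \<noteq> 0"
    using line_nonzero[OF l] by blast
  obtain b where b: "b \<in> l" "b \<notin> vec.span {a}" "l = vec.span {a, b}"
    using line_basis[OF l a] by blast
  obtain c where c: "c \<in> m" "c \<noteq> 0"
    using line_nonzero[OF m] by blast
  obtain d where d: "d \<in> m" "d \<notin> vec.span {c}" "m = vec.span {c, d}"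
    using line_basis[OF m c] by blast
  have "c \<notin> vec.span {a, b}"
    using opposite_zero b(3) c by blast
  then have "vec.dim {c, a, b} = 3"
    using dim_span_pair[OF a(2) b(2)] by (simp add: vec.dim_insert[of c])
  moreover have "d \<notin> vec.span {c, a, b}"
  proof
    assume "d \<in> vec.span {c, a, b}"
    then obtain k where "d - k *s c \<in> l"
      unfolding b(3) vec.span_breakdown_eq[of d c] by blast
    moreover have "d - k *s c \<in> m"
      using c(1) d(1) lineD(1)[OF m] by (simp add: vec.subspace_diff vec.subspace_scale)
    ultimately have "d = k *s c"
      using opposite_zero by fastforce
    then show False
      using d(2) unfolding vec.span_singleton by blast
  qed
  ultimately have "vec.dim {d, c, a, b} = 4"
    by (simp add: vec.dim_insert[of d])
  then have "vec.span {d, c, a, b} = UNIV"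
    by (intro span_eq_UNIV_of_dim) simp
  moreover have "{d, c, a, b} = {a, b} \<union> {c, d}"
    by blast
  ultimately have "vec.span ({a, b} \<union> {c, d}) = UNIV"
    by simp
  then show thesis
    using that unfolding vec.span_Un b(3) d(3) by blast
qed

text \<open>Since \<open>l\<close> is totally isotropic and \<open>l\<close> and \<open>m\<close>
  span the space, such an \<open>r\<close> is orthogonal to everything. So \<open>h\<close> pairs
  \<open>l\<close> and \<open>m\<close> nondegenerately.\<close>

lemma eq_0_if_perp:
  assumes "r \<in> l" and "\<And>z. z \<in> m \<Longrightarrow> h r z = 0"
  shows "r = 0"
proof -
  have "h r x = 0" for x
  proof -
    obtain y z where "y \<in> l" "z \<in> m" "x = y + z"
      using decompose by blast
    then show ?thesis
      using assms lineD(3)[OF l] by (simp add: h_add_right)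
  qed
  then show ?thesis
    using nondeg unfolding nondegenerate_def by blast
qed

text \<open>A point of \<open>M\<close> with components x1 in \<open>l\<close> and x2 in
  \<open>m\<close> can only lie on the transversal spanned by x1 and x2, which is totally isotropic
  iff \<open>h x1 x2 = 0\<close>. Only the points u + t v are counted, which already yields
  q.\<close>

lemma card_transversals_meeting:
  assumes M: "M \<in> lines" and "\<not> meets M l" and "\<not> meets M m"
  shows "q \<le> card {L \<in> transversals. meets L M}"
proof -
  obtain u where u: "u \<in> M" "u \<noteq> 0"
    using line_nonzero[OF M] by blast
  obtain v where v: "v \<in> M" "v \<notin> vec.span {u}"
    using line_basis[OF M u] by blast
  obtain u1 u2 where u12: "u1 \<in> l" "u2 \<in> m" "u = u1 + u2"
    using decompose by blast
  obtain v1 v2 where v12: "v1 \<in> l" "v2 \<in> m" "v = v1 + v2"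
    using decompose by blast
  note sub_l = lineD(1)[OF l] and sub_m = lineD(1)[OF m] and sub_M = lineD(1)[OF M]
  have M_uv: "s *s u + t *s v \<in> M" for s t
    using sub_M u(1) v(1) by (simp add: vec.subspace_add vec.subspace_scale)
  have l_uv: "s *s u1 + t *s v1 \<in> l" for s t
    using sub_l u12(1) v12(1) by (simp add: vec.subspace_add vec.subspace_scale)
  have m_uv: "s *s u2 + t *s v2 \<in> m" for s t
    using sub_m u12(2) v12(2) by (simp add: vec.subspace_add vec.subspace_scale)
  have uv: "s *s u + t *s v = (s *s u1 + t *s v1) + (s *s u2 + t *s v2)" for s t
    by (simp add: u12(3) v12(3) vector_add_ldistrib)
  \<comment> \<open>The projections of \<open>M\<close> to \<open>l\<close> and to \<open>m\<close>
    are injective, as a kernel vector would lie in \<open>M\<close> and in the other line.\<close>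
  have indep1: "s = 0 \<and> t = 0" if "s *s u1 + t *s v1 = 0" for s t
  proof -
    have "s *s u + t *s v \<in> m"
      using m_uv[of s t] uv[of s t] that by simp
    then have "s *s u + t *s v = 0"
      using assms(3) M_uv meetsI by blast
    then show ?thesis
      using pair_independent[OF u(2) v(2)] by blast
  qed
  have indep2: "s = 0 \<and> t = 0" if "s *s u2 + t *s v2 = 0" for s t
  proof -
    have "s *s u + t *s v \<in> l"
      using l_uv[of s t] uv[of s t] that by simp
    then have "s *s u + t *s v = 0"
      using assms(2) M_uv meetsI by blast
    then show ?thesis
      using pair_independent[OF u(2) v(2)] by blast
  qed
  have pair: "y \<notin> vec.span {x}" if "x \<noteq> 0" "\<And>s t. s *s x + t *s y = 0 \<Longrightarrow> s = 0 \<and> t = 0"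
    for x y :: "'a ^ 4"
  proof
    assume "y \<in> vec.span {x}"
    then obtain k where "y = k *s x"
      unfolding vec.span_singleton by blast
    then show False
      using that(2)[of k "- 1"] by simp
  qed
  have "u1 \<noteq> 0" "u2 \<noteq> 0"
    using indep1[of 1 0] indep2[of 1 0] by auto
  then have l_eq: "l = vec.span {u1, v1}" and m_eq: "m = vec.span {u2, v2}"
    using line_eq_span[OF l u12(1) v12(1)] line_eq_span[OF m u12(2) v12(2)] pair indep1 indep2
    by blast+

  define e f k g where "e = h u1 u2" and "f = h u1 v2" and "k = h v1 u2" and "g = h v1 v2"
  have iso: "h x y = 0" if "x \<in> l \<and> y \<in> l \<or> x \<in> m \<and> y \<in> m \<or> x \<in> M \<and> y \<in> M" for x y
    using that lineD(3) l m M by blast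
  \<comment> \<open>All three lines are totally isotropic, so only the cross terms survive in the
    expansion. This is the skew-hermitian symmetry.\<close>
  have cross: "h x2 y1 = - h x1 y2"
    if "x1 \<in> l" "x2 \<in> m" "y1 \<in> l" "y2 \<in> m" "x1 + x2 \<in> M" "y1 + y2 \<in> M" for x1 x2 y1 y2
  proof -
    have "h (x1 + x2) (y1 + y2) = 0" "h x1 y1 = 0" "h x2 y2 = 0"
      using iso that by blast+
    then show ?thesis
      by (simp add: h_add_left h_add_right eq_neg_iff_add_eq_0 add.commute)
  qed
  have e: "e ^ q = - e"
    using cross[of u1 u2 u1 u2] h_conj[of u2 u1] u12 u(1) by (simp add: e_def)
  have g: "g ^ q = - g"
    using cross[of v1 v2 v1 v2] h_conj[of v2 v1] v12 v(1) by (simp add: g_def)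
  have k: "k = - (f ^ q)"
    using cross[of u1 u2 v1 v2] h_conj[of v1 u2] u12 v12 u(1) v(1)
    by (simp add: k_def f_def conj_uminus)
  \<comment> \<open>The Gram determinant of the pairing of \<open>l\<close> with \<open>m\<close>:
    if it vanished, a nonzero vector of \<open>l\<close> would be orthogonal to
    \<open>m\<close>.\<close>
  have det: "e * g \<noteq> f * k"
  proof
    assume eq: "e * g = f * k"
    have zero: "s = 0 \<and> t = 0" if "s * e + t * k = 0" "s * f + t * g = 0" for s t
    proof -
      let ?r = "s *s u1 + t *s v1"
      have "h ?r y = 0" if "y \<in> {u2, v2}" for y
        using that \<open>s * e + t * k = 0\<close> \<open>s * f + t * g = 0\<close>
        by (auto simp: h_add_left h_scale_left e_def f_def k_def g_def)
      then have "h ?r z = 0" if "z \<in> m" for z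
        using perp_span[of "{u2, v2}" ?r z] that m_eq by simp
      then show ?thesis
        using eq_0_if_perp[OF l_uv] indep1 by blast
    qed
    show False
      \<comment> \<open>The first two instances solve the system because the determinant vanishes,
        so all four entries are zero; then (1, 0) is a nontrivial solution.\<close>
      using zero[of g "- f"] zero[of k "- e"] zero[of 1 0] eq by (auto simp: mult.commute)
  qed

  (* Scaling by a skew c turns the skew-hermitian form (x1 + x2, y1 + y2) |-> h x1 y2 on M
     into a hermitian one, whose isotropic points are those on transversals. *)
  obtain c :: 'a where c: "c \<noteq> 0" "c ^ q = - c"
    using exists_skew by blast
  define T where "T = {t. h (u1 + t *s v1) (u2 + t *s v2) = 0}"
  have "h (u1 + t *s v1) (u2 + t *s v2) = 0 \<longleftrightarrow>
      c * e + (c * f) * t ^ q + (c * f) ^ q * t + (c * g) * t ^ (q + 1) = 0" for t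
  proof -
    have "c * h (u1 + t *s v1) (u2 + t *s v2) =
      c * e + (c * f) * t ^ q + (c * f) ^ q * t + (c * g) * t ^ (q + 1)"
      using k by (simp add: h_simps e_def f_def k_def g_def power_mult_distrib c(2) algebra_simps)
    then show ?thesis
      using c(1) by (metis mult_eq_0_iff)
  qed
  moreover have "q \<le> card {t. c * e + (c * f) * t ^ q + (c * f) ^ q * t + (c * g) * t ^ (q + 1) = 0}"
  proof (rule card_hermitian_equation)
    show "(c * e) ^ q = c * e" "(c * g) ^ q = c * g"
      by (simp_all add: power_mult_distrib c(2) e g)
    \<comment> \<open>Both terms of the discriminant carry the factor \<open>c * c\<close>, so its
      nonvanishing reduces to \<open>det\<close>.\<close>
    have *: "(c * f) ^ (q + 1) = (c * c) * (f * k)"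
      by (simp add: power_mult_distrib c(2) k)
    have **: "c * e * (c * g) = (c * c) * (e * g)"
      by (simp add: mult.assoc mult.left_commute)
    show "c * e * (c * g) \<noteq> (c * f) ^ (q + 1)"
      unfolding * ** using det c(1) by simp
  qed
  ultimately have "q \<le> card T"
    unfolding T_def by simp

  define L where "L t = vec.span {u1 + t *s v1, u2 + t *s v2}" for t
  have a: "u1 + t *s v1 \<in> l" "u1 + t *s v1 \<noteq> 0" for t
    using l_uv[of 1 t] indep1[of 1 t] by auto
  have b: "u2 + t *s v2 \<in> m" "u2 + t *s v2 \<noteq> 0" for t
    using m_uv[of 1 t] indep2[of 1 t] by auto
  have ab: "u1 + t *s v1 + (u2 + t *s v2) \<in> M" "u1 + t *s v1 + (u2 + t *s v2) \<noteq> 0" for t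
    using M_uv[of 1 t] uv[of 1 t] pair_independent(1)[OF u(2) v(2), of 1 t] by auto
  have in_L: "u1 + t *s v1 \<in> L t" "u2 + t *s v2 \<in> L t" for t
    by (simp_all add: L_def vec.span_base)
  have line_L: "L t \<in> lines" if "t \<in> T" for t
  proof -
    have "u2 + t *s v2 \<notin> vec.span {u1 + t *s v1}"
      using line_closed[OF l a(1)] b opposite_zero by blast
    then show ?thesis
      unfolding L_def
      by (rule span_pair_line[OF a(2)]) (use that a b iso in \<open>auto simp: T_def\<close>)
  qed
  have trans_L: "L t \<in> transversals" if "t \<in> T" for t
    unfolding transversals_def using line_L[OF that] in_L a b meetsI by blast
  have "inj_on L T"
  proof (rule inj_onI, rule ccontr)
    fix t t' assume t: "t \<in> T" "t' \<in> T" "L t = L t'" "t \<noteq> t'"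
    note sub = lineD(1)[OF line_L[OF t(1)]]
    have "v1 \<in> L t" "u1 \<in> L t"
      using subspace_direction[OF sub in_L(1)[of t], of t'] in_L(1)[of t'] t(3,4) by simp_all
    then have "L t = l"
      using line_eq_span[OF line_L[OF t(1)] _ \<open>v1 \<in> L t\<close> \<open>u1 \<noteq> 0\<close>] pair indep1 \<open>u1 \<noteq> 0\<close> l_eq by blast
    then show False
      using transversalD(4)[OF trans_L[OF t(1)]] by blast
  qed
  moreover have "meets (L t) M" if "t \<in> T" for t
    using meetsI[of "u1 + t *s v1 + (u2 + t *s v2)"] ab
      vec.subspace_add[OF lineD(1)[OF line_L[OF that]] in_L] by blast
  ultimately have "card T \<le> card {L \<in> transversals. meets L M}"
    using trans_L by (intro card_inj_on_le[of L]) auto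
  then show ?thesis
    using \<open>q \<le> card T\<close> by simp
qed

end

section \<open>Replacing transversals by branches\<close>

context hermitian_space
begin

text \<open>For a transversal \<open>L\<close>, the triple intersection says that \<open>U\<close>
  passes through the point where \<open>L\<close> meets \<open>l\<close>. With \<open>l\<close> as
  an explicit argument, the same notion serves at \<open>m\<close>.\<close>

definition branches :: "('a ^ 4) set \<Rightarrow> ('a ^ 4) set \<Rightarrow> ('a ^ 4) set \<Rightarrow> bool" where
  "branches l L U \<longleftrightarrow> U \<in> lines \<and> U \<noteq> L \<and> U \<noteq> l \<and> U \<inter> L \<inter> l \<noteq> {0}"

end

context opposite_lines
begin

text \<open>The situation is symmetric in \<open>l\<close> and \<open>m\<close>, so every fact about
  branches at \<open>l\<close> transfers to branches at \<open>m\<close>.\<close>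

lemma swap: "opposite_lines q h m l"
  by unfold_locales (use l m opposite meets_commute in auto)

lemma swap_transversals: "opposite_lines.transversals h m l = transversals"
  unfolding opposite_lines.transversals_def[OF swap] transversals_def by blast

lemma branchesD:
  assumes "L \<in> transversals" and "branches l L U"
  shows "U \<in> lines" and "U \<noteq> L" and "meets U L" and "meets U l"
    and "U \<inter> L \<subseteq> l" and "U \<inter> l \<subseteq> L" and "L \<inter> l \<subseteq> U"
proof -
  note L = transversalD[OF assms(1)]
  show U: "U \<in> lines" and "U \<noteq> L"
    using assms(2) by (auto simp: branches_def)
  have "U \<noteq> l" "U \<inter> L \<inter> l \<noteq> {0}"
    using assms(2) by (auto simp: branches_def)
  moreover have "0 \<in> U \<inter> L \<inter> l"
    using zero_in_line U L(1) l by blast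
  ultimately obtain x where x: "x \<in> U" "x \<in> L" "x \<in> l" "x \<noteq> 0"
    by blast
  show "meets U L" "meets U l"
    using x meetsI by blast+
  show "U \<inter> L \<subseteq> l" "U \<inter> l \<subseteq> L" "L \<inter> l \<subseteq> U"
    using common_point_unique[of U L l x] common_point_unique[of U l L x]
      common_point_unique[of L l U x] x U L(1,4) l \<open>U \<noteq> L\<close> \<open>U \<noteq> l\<close> by blast+
qed

text \<open>This and the next three lemmas share one argument: a common point would close a triangle
  with \<open>l\<close>, \<open>L\<close> or \<open>m\<close>, whose point of concurrency
  contradicts the disjointness of transversals or of \<open>l\<close> and \<open>m\<close>.\<close>

lemma branch_disjoint_transversal:
  assumes "L \<in> transversals" and "branches l L U" and "L' \<in> transversals" and "L' \<noteq> L"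
  shows "\<not> meets U L'"
proof
  note U = branchesD[OF assms(1,2)] and L' = transversalD[OF assms(3)]
  assume "meets U L'"
  then obtain x where "x \<in> U" "x \<in> L'" "x \<in> l" "x \<noteq> 0"
    using triangle_concurrent[OF U(1) L'(1) l _ L'(2) U(4)] by blast
  then show False
    using U(6) transversals_disjoint[OF assms(1,3)] assms(4) meetsI by blast
qed

lemma branches_disjoint:
  assumes "L \<in> transversals" and "branches l L U" and "L' \<in> transversals" and "branches l L' U'"
    and "L \<noteq> L'"
  shows "\<not> meets U U'"
proof
  note U = branchesD[OF assms(1,2)] and U' = branchesD[OF assms(3,4)]
  assume "meets U U'"
  then obtain x where "x \<in> U" "x \<in> U'" "x \<in> l" "x \<noteq> 0"
    using triangle_concurrent[OF U(1) U'(1) l _ U'(4) U(4)] by blast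
  then show False
    using U(6) U'(6) transversals_disjoint[OF assms(1,3,5)] meetsI by blast
qed

lemma opposite_branches_disjoint:
  assumes "L \<in> transversals" and "branches l L U" and "branches m L W"
  shows "\<not> meets U W"
proof
  note U = branchesD[OF assms(1,2)]
  note W = opposite_lines.branchesD[OF swap, unfolded swap_transversals, OF assms(1,3)]
  assume "meets U W"
  then obtain x where "x \<in> U" "x \<in> W" "x \<in> L" "x \<noteq> 0"
    using triangle_concurrent[OF U(1) W(1) transversalD(1)[OF assms(1)] _ W(3) U(3)] by blast
  then show False
    using U(5) W(5) opposite_zero by blast
qed

lemma branch_disjoint_opposite:
  assumes "L \<in> transversals" and "branches l L U"
  shows "\<not> meets U m"
proof
  note U = branchesD[OF assms] and L = transversalD[OF assms(1)]
  assume "meets U m"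
  then obtain x where "x \<in> U" "x \<in> L" "x \<in> m" "x \<noteq> 0"
    using triangle_concurrent[OF U(1) L(1) m U(3) L(3)] by blast
  then show False
    using U(5) opposite_zero by blast
qed

text \<open>The greedy step. Two lines through \<open>x\<close> meeting the same \<open>B\<close>
  would form a triangle with it, forcing \<open>B\<close> through the point \<open>x\<close> of
  \<open>l\<close>. So each \<open>B\<close> blocks at most one candidate.\<close>

lemma branch_avoiding:
  assumes "L \<in> transversals" and "finite \<B>" and "card \<B> + 2 \<le> q"
    and \<B>: "\<And>B. B \<in> \<B> \<Longrightarrow> B \<in> lines \<and> \<not> meets B l"
  obtains U where "branches l L U" and "\<And>B. B \<in> \<B> \<Longrightarrow> \<not> meets U B"
proof -
  note L = transversalD[OF assms(1)]
  obtain x where x: "x \<in> L" "x \<in> l" "x \<noteq> 0"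
    using meetsE[OF L(2,1) l] by blast
  define X where "X = {N \<in> lines. x \<in> N \<and> N \<noteq> l}"
  define bad where "bad B = {N \<in> X. meets N B}" for B
  have "card (bad B) \<le> 1" if "B \<in> \<B>" for B
  proof -
    have "N = N'" if N: "N \<in> bad B" "N' \<in> bad B" for N N'
    proof (rule ccontr)
      assume "N \<noteq> N'"
      have lines: "N \<in> lines" "N' \<in> lines" "B \<in> lines" and in_N: "x \<in> N" "x \<in> N'"
        and "meets N B" "meets N' B"
        using N \<B>[OF \<open>B \<in> \<B>\<close>] by (auto simp: bad_def X_def)
      then obtain y where "y \<in> N" "y \<in> N'" "y \<in> B" "y \<noteq> 0"
        using triangle_concurrent[OF lines] meetsI x(3) by metis
      then have "x \<in> B"
        using common_point_unique[OF lines(1,2) \<open>N \<noteq> N'\<close> lines(3)] in_N by blast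
      then show False
        using \<B>[OF \<open>B \<in> \<B>\<close>] meetsI x(2,3) by blast
    qed
    then show ?thesis
      by (simp add: card_le_Suc0_iff_eq)
  qed
  then have "card (\<Union>B\<in>\<B>. bad B) \<le> card \<B>"
    using card_UN_le[OF assms(2), of bad] sum_bounded_above[of \<B> "\<lambda>B. card (bad B)" 1] by simp
  \<comment> \<open>Besides the blocked lines, \<open>L\<close> itself is excluded; the summand 2 in
    the bound on \<open>card \<B>\<close> pays for \<open>L\<close> and for strictness.\<close>
  then have "card (insert L (\<Union>B\<in>\<B>. bad B)) < q"
    using assms(3) by (simp add: card_insert_if)
  also have "q \<le> card X"
    unfolding X_def by (rule card_lines_through_point[OF l x(2,3)])
  finally have "\<not> X \<subseteq> insert L (\<Union>B\<in>\<B>. bad B)"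
    by (meson card_mono finite not_le)
  then obtain U where U: "U \<in> X" "U \<noteq> L" "\<And>B. B \<in> \<B> \<Longrightarrow> U \<notin> bad B"
    by blast
  then have "branches l L U"
    using x by (auto simp: branches_def X_def)
  then show thesis
    using that U by (auto simp: bad_def)
qed

text \<open>Transversals are treated one at a time: \<open>U\<close> avoids the earlier branches at
  \<open>m\<close>, \<open>W\<close> the earlier ones at \<open>l\<close>, and \<open>U\<close> and
  \<open>W\<close> are disjoint because they branch from the same \<open>L\<close>. Branches at the
  same line need no condition, being disjoint anyway.\<close>

lemma exists_branch_families:
  assumes "finite \<F>" and "\<F> \<subseteq> transversals" and "card \<F> < q"
  shows "\<exists>A B. \<forall>L\<in>\<F>. branches l L (A L) \<and> branches m L (B L) \<and> (\<forall>L'\<in>\<F>. \<not> meets (A L) (B L'))"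
  using assms
proof (induction rule: finite_induct)
  case (insert L \<F>)
  interpret swap: opposite_lines q F h m l
    by (rule swap)
  have L: "L \<in> transversals" and \<F>: "\<F> \<subseteq> transversals" and card: "card \<F> + 2 \<le> q"
    using insert.prems insert.hyps by auto
  obtain A B where "\<forall>L\<in>\<F>. branches l L (A L) \<and> branches m L (B L)
      \<and> (\<forall>L'\<in>\<F>. \<not> meets (A L) (B L'))"
    using insert.IH[OF \<F>] card by auto
  then have AB: "\<And>L. L \<in> \<F> \<Longrightarrow> branches l L (A L)" "\<And>L. L \<in> \<F> \<Longrightarrow> branches m L (B L)"
    "\<And>L L'. L \<in> \<F> \<Longrightarrow> L' \<in> \<F> \<Longrightarrow> \<not> meets (A L) (B L')"
    by blast+
  have card_image: "card (A ` \<F>) + 2 \<le> q" "card (B ` \<F>) + 2 \<le> q"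
    using card_image_le[OF insert.hyps(1), of A] card_image_le[OF insert.hyps(1), of B] card by simp_all
  have A: "C \<in> lines \<and> \<not> meets C m" if "C \<in> A ` \<F>" for C
    using that \<F> AB(1) branchesD(1) branch_disjoint_opposite by blast
  have B: "C \<in> lines \<and> \<not> meets C l" if "C \<in> B ` \<F>" for C
    using that \<F> AB(2) swap.branchesD(1) swap.branch_disjoint_opposite
    unfolding swap_transversals by blast
  obtain U where U: "branches l L U" "\<And>C. C \<in> B ` \<F> \<Longrightarrow> \<not> meets U C"
    using branch_avoiding[OF L _ card_image(2) B] insert.hyps(1) by blast
  obtain W where W: "branches m L W" "\<And>C. C \<in> A ` \<F> \<Longrightarrow> \<not> meets W C"
    using swap.branch_avoiding[OF _ _ card_image(1) A, of L] L insert.hyps(1)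
    unfolding swap_transversals by blast
  have "\<not> meets U W"
    using opposite_branches_disjoint[OF L U(1) W(1)] .
  moreover have "\<not> meets (A L') W" if "L' \<in> \<F>" for L'
    using W(2) that meets_commute by blast
  ultimately show ?case
    using AB U W(1)
    by (intro exI[of _ "A(L := U)"] exI[of _ "B(L := W)"]) auto
qed simp

text \<open>Each of the \<open>k\<close> replaced transversals is exchanged for two branches, a net
  gain of \<open>k\<close> over all \<open>q\<^sup>2 + 1\<close> transversals.\<close>

lemma maximal_partial_spread_of_card:
  assumes "k < q"
  shows "\<exists>S. maximal_partial_spread h S \<and> card S = q\<^sup>2 + 1 + k"
proof -
  interpret swap: opposite_lines q F h m l
    by (rule swap)
  have "q \<le> q\<^sup>2"
    by (simp add: power2_nat_le_imp_le self_le_power)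
  then obtain \<F> where \<F>: "\<F> \<subseteq> transversals" "card \<F> = k"
    using obtain_subset_with_card_n[of k transversals] card_transversals assms by auto
  then obtain A B where "\<forall>L\<in>\<F>. branches l L (A L) \<and> branches m L (B L)
      \<and> (\<forall>L'\<in>\<F>. \<not> meets (A L) (B L'))"
    using exists_branch_families[of \<F>] assms by auto
  then have A: "\<And>L. L \<in> \<F> \<Longrightarrow> branches l L (A L)"
    and B: "\<And>L. L \<in> \<F> \<Longrightarrow> branches m L (B L)"
    and AB: "\<And>L L'. L \<in> \<F> \<Longrightarrow> L' \<in> \<F> \<Longrightarrow> \<not> meets (A L) (B L')"
    by blast+
  have trans: "L \<in> transversals" if "L \<in> \<F>" for L
    using \<F>(1) that by blast
  have A_lines: "A L \<in> lines" and B_lines: "B L \<in> lines" if "L \<in> \<F>" for L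
    using branchesD(1) swap.branchesD(1) A B trans that unfolding swap_transversals by blast+
  have A_trans: "\<not> meets (A L) L'" and B_trans: "\<not> meets (B L) L'"
    if "L \<in> \<F>" "L' \<in> transversals - \<F>" for L L'
    using branch_disjoint_transversal[of L "A L" L'] swap.branch_disjoint_transversal[of L "B L" L']
      A B trans that unfolding swap_transversals by blast+
  have A_A: "\<not> meets (A L) (A L')" and B_B: "\<not> meets (B L) (B L')"
    if "L \<in> \<F>" "L' \<in> \<F>" "L \<noteq> L'" for L L'
    using branches_disjoint[of L "A L" L' "A L'"] swap.branches_disjoint[of L "B L" L' "B L'"]
      A B trans that unfolding swap_transversals by blast+

  define S where "S = (transversals - \<F>) \<union> A ` \<F> \<union> B ` \<F>"
  have S_lines: "S \<subseteq> lines"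
    using transversalD(1) A_lines B_lines by (auto simp: S_def)
  have sym: "\<not> meets W U" if "\<not> meets U W" for U W
    using that by (simp add: meets_commute)
  have "\<not> meets U W" if "U \<in> S" "W \<in> S" "U \<noteq> W" for U W
  proof -
    have "\<not> meets (A L) (A L')" if "L \<in> \<F>" "L' \<in> \<F>" "A L \<noteq> A L'" for L L'
      using A_A[OF that(1,2)] that(3) by blast
    moreover have "\<not> meets (B L) (B L')" if "L \<in> \<F>" "L' \<in> \<F>" "B L \<noteq> B L'" for L L'
      using B_B[OF that(1,2)] that(3) by blast
    ultimately show ?thesis
      using that unfolding S_def
      by (elim UnE imageE) (simp_all add: transversals_disjoint A_trans B_trans AB
          A_trans[THEN sym] B_trans[THEN sym] AB[THEN sym])
  qed
  then have spread: "partial_spread h S"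
    using S_lines by (auto simp: partial_spread_def pairwise_def meets_def)

  \<comment> \<open>For the cardinality, the three constituents of \<open>S\<close> must be disjoint
    as sets of lines and \<open>A\<close>, \<open>B\<close> injective; both follow because a line
    meets itself.\<close>
  have neq: "U \<noteq> W" if "U \<in> lines" "\<not> meets U W" for U W
    using that meets_self by blast
  have "inj_on A \<F>" "inj_on B \<F>"
    using A_A B_B A_lines B_lines meets_self by (metis inj_onI)+
  then have card_images: "card (A ` \<F>) = k" "card (B ` \<F>) = k"
    using card_image \<F>(2) by blast+
  have "(transversals - \<F>) \<inter> A ` \<F> = {}" "((transversals - \<F>) \<union> A ` \<F>) \<inter> B ` \<F> = {}"
    using neq[OF A_lines A_trans] neq[OF B_lines B_trans] neq[OF A_lines AB] by blast+
  then have "card S = card (transversals - \<F>) + k + k"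
    unfolding S_def using card_images by (simp add: card_Un_disjoint)
  moreover have "card (transversals - \<F>) = q\<^sup>2 + 1 - k"
    using \<F> card_transversals by (simp add: card_Diff_subset)
  ultimately have card_S: "card S = q\<^sup>2 + 1 + k"
    using \<open>q \<le> q\<^sup>2\<close> assms by simp

  \<comment> \<open>Maximality. Points of \<open>l\<close> and \<open>m\<close> remain covered,
    since the branches pass through the points of the transversals they replace. A line missing both
    meets at least q transversals, of which only \<open>k\<close> < q were removed.\<close>
  have blocking: "\<exists>U\<in>S. meets M U" if M: "M \<in> lines" for M
  proof -
    consider (l) "meets M l" | (m) "meets M m" | (none) "\<not> meets M l" "\<not> meets M m"
      by blast
    then show ?thesis
    proof cases
      case l
      then obtain x where x: "x \<in> M" "x \<in> l" "x \<noteq> 0"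
        using meetsE M opposite_lines_axioms opposite_lines.l by metis
      obtain L where L: "L \<in> transversals" "x \<in> L"
        using transversal_through_point[OF x(2,3)] by blast
      show ?thesis
      proof (cases "L \<in> \<F>")
        case True
        then have "x \<in> A L"
          using branchesD(7)[OF L(1) A] L(2) x(2) by blast
        then show ?thesis
          using True x meetsI by (auto simp: S_def)
      next
        case False
        then show ?thesis
          using L x meetsI by (auto simp: S_def)
      qed
    next
      case m
      then obtain x where x: "x \<in> M" "x \<in> m" "x \<noteq> 0"
        using meetsE M swap.l by metis
      obtain L where L: "L \<in> transversals" "x \<in> L"
        using swap.transversal_through_point[OF x(2,3)] unfolding swap_transversals by blast
      show ?thesis
      proof (cases "L \<in> \<F>")
        case True
        then have "x \<in> B L"
          using swap.branchesD(7)[of L "B L"] B L x(2) unfolding swap_transversals by blast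
        then show ?thesis
          using True x meetsI by (auto simp: S_def)
      next
        case False
        then show ?thesis
          using L x meetsI by (auto simp: S_def)
      qed
    next
      case none
      have "\<not> {L \<in> transversals. meets L M} \<subseteq> \<F>"
      proof
        assume "{L \<in> transversals. meets L M} \<subseteq> \<F>"
        then have "card {L \<in> transversals. meets L M} \<le> k"
          using card_mono[of \<F>] \<F>(2) by simp
        then show False
          using card_transversals_meeting[OF M none] assms by simp
      qed
      then show ?thesis
        using meets_commute unfolding S_def by blast
    qed
  qed
  have "\<not> (\<exists>T. partial_spread h T \<and> S \<subset> T)"
  proof
    assume "\<exists>T. partial_spread h T \<and> S \<subset> T"
    then obtain T M where T: "partial_spread h T" "S \<subseteq> T" "M \<in> T" "M \<notin> S"
      by blast
    have "M \<in> lines"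
      using T(1,3) unfolding partial_spread_def by blast
    then obtain U where U: "U \<in> S" "meets M U"
      using blocking by blast
    then have "M \<noteq> U" "U \<in> T"
      using T(2,4) by auto
    then show False
      using T(1,3) U(2) by (auto simp: partial_spread_def pairwise_def meets_def)
  qed
  then show ?thesis
    using spread card_S unfolding maximal_partial_spread_def by blast
qed

end

theorem theorem5p4:
  fixes h :: "'a::{field,finite} ^ 4 \<Rightarrow> 'a ^ 4 \<Rightarrow> 'a"
    and q N :: nat
  assumes "primepow q"
    and "CARD('a) = q\<^sup>2"
    and "hermitian_form q h"
    and "nondegenerate h"
    and "q\<^sup>2 + 1 \<le> N"
    and "N \<le> q\<^sup>2 + q"
  shows "\<exists>S. maximal_partial_spread h S \<and> card S = N"
proof -
  interpret hermitian_space q "TYPE('a)" h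
    by unfold_locales (use assms in auto)
  obtain U W where "U \<in> lines" "W \<in> lines" "\<not> meets U W"
    using exists_opposite_lines by blast
  then interpret opposite_lines q "TYPE('a)" h U W
    by unfold_locales
  show ?thesis
    \<comment> \<open>The upper bound on \<open>N\<close> makes this excess at most q - 1, as the
      greedy choice requires.\<close>
    using maximal_partial_spread_of_card[of "N - (q\<^sup>2 + 1)"] assms(5,6) q_ge_2 by auto
qed

end
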